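(* Let $(E,\|\cdot\|)$ be a finite-dimensional Euclidean space and let $f:E\to\mathbb{R}$ be convex and $L$-smooth. Let $\psi^*(\mathbf{z})=\frac{1}{2\mu}\|\mathbf{z}\|^2$ with $0<\mu<L$, let $a_i>0$, $A_k=\sum_{i=0}^k a_i$, $H_i=A_i^\lambda$, and $\frac{a_i^2}{A_i^{2-\lambda}}=c\frac{\mu}{L}$ for all $i\ge1$, for some $\lambda\in[0,2]$, $c\in(0,1]$, and $c\frac{\mu}{L}<1$. Let $\mathbf{x}_0=\mathbf{y}_0=\nabla\psi^*(\mathbf{z}_0)$ be arbitrary and let $\mathbf{x}_k,\mathbf{y}_k,\mathbf{z}_k$ evolve, for $k\ge1$, as $$\mathbf{x}_k=\frac{A_{k-1}}{A_k}\mathbf{y}_{k-1}+\frac{a_k}{A_k}\nabla\psi^*(\mathbf{z}_{k-1}),\quad \mathbf{z}_k=\mathbf{z}_{k-1}-\frac{a_k}{A_k}H_k\nabla f(\mathbf{x}_k),\quad \mathbf{y}_k=\mathbf{x}_k+\frac{a_k}{A_k}\left(\nabla\psi^*(\mathbf{z}_k)-\nabla\psi^*(\mathbf{z}_{k-1})\right).$$ Then, for all $k\ge1$, $$\min_{1\le i\le k}\|\nabla f(\mathbf{x}_i)\|^2=O\left(\frac{L(f(\mathbf{x}_0)-f(\mathbf{x}^* ))}{c(1-c)k+c\min\{\log k/\lambda,\;k\sqrt{c\mu/L}\}}\right).$$ In particular, for $c=\frac12$, $\min_{1\le i\le k}\|\nabla f(\mathbf{x}_i)\|^2=O\left(\frac{L(f(\mathbf{x}_0)-f(\mathbf{x}^*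 ))}{k}\right)$.
   Context: $f$ is continuously differentiable, and $L$-smooth means $\|\nabla f(\mathbf{x})-\nabla f(\mathbf{y})\|\le L\|\mathbf{x}-\mathbf{y}\|$ for all $\mathbf{x},\mathbf{y}\in E$. $\mathbf{x}^*\in\mathrm{argmin}_{\mathbf{x}\in E}f(\mathbf{x})$ is any fixed minimizer. The Euclidean space is identified with its dual; $\psi^*$ is the convex conjugate of $\psi(\mathbf{x})=\frac{\mu}{2}\|\mathbf{x}\|^2$, so $\nabla\psi^*(\mathbf{z})=\mathbf{z}/\mu$. *)

theory Defs
  imports "HOL-Analysis.Analysis" "HOL-Library.Extended_Real"
begin

text \<open>
  Euclidean spaces are modelled as finite-dimensional subspaces of an arbitrary real inner
  product space, rather than as a type of class \<open>euclidean_space\<close>, so that \<open>E\<close> can be quantified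
  inside a formula: the constant hidden in an \<open>O\<close>-bound can then be chosen before \<open>E\<close>, and hence
  independently of the dimension (the ambient type may contain subspaces of every finite dimension).
  Taking \<open>E = UNIV\<close> recovers the case of a type of class \<open>euclidean_space\<close>.
  Functions on \<open>E\<close> are total functions whose values outside \<open>E\<close> are irrelevant.
\<close>

definition euclidean_subspace :: "'a::real_inner set \<Rightarrow> bool" where
  "euclidean_subspace E \<longleftrightarrow> (\<exists>B. finite B \<and> E = span B)"

text \<open>Requiring \<open>g \<in> E\<close> makes the gradient relative to \<open>E\<close> unique (identification of \<open>E\<close> with its dual).\<close>

definition has_gradient_on :: "'a::real_inner set \<Rightarrow> ('a \<Rightarrow> real) \<Rightarrow> 'a \<Rightarrow> 'a \<Rightarrow> bool" where
  "has_gradient_on E f x g \<longleftrightarrow> g \<in> E \<and> (f has_derivative (\<lambda>h. g \<bullet> h)) (at x within E)"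

definition grad_on :: "'a::real_inner set \<Rightarrow> ('a \<Rightarrow> real) \<Rightarrow> 'a \<Rightarrow> 'a" where
  "grad_on E f x = (THE g. has_gradient_on E f x g)"

lemma has_gradient_on_unique:
  assumes "subspace E" "x \<in> E" "has_gradient_on E f x g" "has_gradient_on E f x g'"
  shows "g = g'"
proof -
  define h where "h = g - g'"
  have h: "h \<in> E"
    using assms by (auto simp: h_def has_gradient_on_def subspace_diff)
  have d: "((\<lambda>t. f (x + t *\<^sub>R h)) has_derivative (\<lambda>t. u \<bullet> (t *\<^sub>R h))) (at 0)"
    if "has_gradient_on E f x u" for u
  proof -
    have sub: "range (\<lambda>t::real. x + t *\<^sub>R h) \<subseteq> E"
      using assms(1,2) h by (auto intro: subspace_add subspace_scale)
    have "(f has_derivative (\<lambda>h. u \<bullet> h)) (at x within range (\<lambda>t::real. x + t *\<^sub>R h))"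
      using that sub by (auto simp: has_gradient_on_def intro: has_derivative_subset)
    moreover have "((\<lambda>t::real. x + t *\<^sub>R h) has_derivative (\<lambda>t. t *\<^sub>R h)) (at 0)"
      by (auto intro!: derivative_eq_intros)
    ultimately show ?thesis
      using has_derivative_in_compose[of "\<lambda>t::real. x + t *\<^sub>R h" "\<lambda>t. t *\<^sub>R h" 0 UNIV f "\<lambda>h. u \<bullet> h"]
      by simp
  qed
  have "(\<lambda>t::real. g \<bullet> (t *\<^sub>R h)) = (\<lambda>t. g' \<bullet> (t *\<^sub>R h))"
    by (rule has_derivative_unique[OF d d]) (use assms in auto)
  from fun_cong[OF this, of 1] have "h \<bullet> h = 0"
    by (simp add: h_def inner_diff_left)
  then show ?thesis by (simp add: h_def)
qed

lemma grad_on_eq: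
  assumes "subspace E" "x \<in> E" "has_gradient_on E f x g"
  shows "grad_on E f x = g"
  unfolding grad_on_def using assms has_gradient_on_unique by blast

definition smooth_fun_on :: "real \<Rightarrow> 'a::real_inner set \<Rightarrow> ('a \<Rightarrow> real) \<Rightarrow> bool" where
  "smooth_fun_on L E f \<longleftrightarrow>
     (\<forall>x\<in>E. \<exists>g. has_gradient_on E f x g) \<and>
     continuous_on E (grad_on E f) \<and>
     (\<forall>x\<in>E. \<forall>y\<in>E. norm (grad_on E f x - grad_on E f y) \<le> L * norm (x - y))"

text \<open>The convex conjugate of \<open>\<psi>(x) = \<mu>/2 * \<parallel>x\<parallel>\<^sup>2\<close>.\<close>

definition psi_star :: "real \<Rightarrow> 'a::real_inner \<Rightarrow> real" where
  "psi_star \<mu> z = (norm z)\<^sup>2 / (2 * \<mu>)"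

lemma grad_on_psi_star:
  assumes "subspace E" "z \<in> E" "0 < \<mu>"
  shows "grad_on E (psi_star \<mu>) z = z /\<^sub>R \<mu>"
proof (rule grad_on_eq[OF assms(1,2)])
  have "(psi_star \<mu> has_derivative (\<lambda>h. (z /\<^sub>R \<mu>) \<bullet> h)) (at z within E)"
    using assms(3) unfolding psi_star_def power2_norm_eq_inner
    by (auto intro!: derivative_eq_intros simp: inner_commute field_simps)
  then show "has_gradient_on E (psi_star \<mu>) z (z /\<^sub>R \<mu>)"
    using assms by (simp add: has_gradient_on_def subspace_scale)
qed

definition step_params :: "real \<Rightarrow> real \<Rightarrow> real \<Rightarrow> real \<Rightarrow> (nat \<Rightarrow> real) \<Rightarrow> bool" where
  "step_params L \<mu> lam c a \<longleftrightarrow>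
     0 < \<mu> \<and> \<mu> < L \<and> 0 \<le> lam \<and> lam \<le> 2 \<and> 0 < c \<and> c \<le> 1 \<and> c * (\<mu> / L) < 1 \<and>
     (\<forall>i. 0 < a i) \<and>
     (\<forall>i\<ge>1. (a i)\<^sup>2 / (\<Sum>j\<le>i. a j) powr (2 - lam) = c * (\<mu> / L))"

definition momentum_iterates ::
    "'a::real_inner set \<Rightarrow> ('a \<Rightarrow> real) \<Rightarrow> real \<Rightarrow> real \<Rightarrow> (nat \<Rightarrow> real) \<Rightarrow>
     (nat \<Rightarrow> 'a) \<Rightarrow> (nat \<Rightarrow> 'a) \<Rightarrow> (nat \<Rightarrow> 'a) \<Rightarrow> bool" where
  "momentum_iterates E f \<mu> lam a x y z \<longleftrightarrow>
     (let A = (\<lambda>k. \<Sum>i\<le>k. a i);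
          H = (\<lambda>k. A k powr lam);
          gradpsi = grad_on E (psi_star \<mu>)
      in z 0 \<in> E \<and> x 0 = gradpsi (z 0) \<and> y 0 = gradpsi (z 0) \<and>
         (\<forall>k\<ge>1.
            x k = (A (k - 1) / A k) *\<^sub>R y (k - 1) + (a k / A k) *\<^sub>R gradpsi (z (k - 1)) \<and>
            z k = z (k - 1) - (a k / A k * H k) *\<^sub>R grad_on E f (x k) \<and>
            y k = x k + (a k / A k) *\<^sub>R (gradpsi (z k) - gradpsi (z (k - 1)))))"

definition momentum_setting ::
    "'a::real_inner set \<Rightarrow> ('a \<Rightarrow> real) \<Rightarrow> 'a \<Rightarrow> real \<Rightarrow> real \<Rightarrow> real \<Rightarrow> real \<Rightarrow> (nat \<Rightarrow> real) \<Rightarrow>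
     (nat \<Rightarrow> 'a) \<Rightarrow> (nat \<Rightarrow> 'a) \<Rightarrow> (nat \<Rightarrow> 'a) \<Rightarrow> bool" where
  "momentum_setting E f xs L \<mu> lam c a x y z \<longleftrightarrow>
     euclidean_subspace E \<and> convex_on E f \<and> smooth_fun_on L E f \<and>
     xs \<in> E \<and> (\<forall>u\<in>E. f xs \<le> f u) \<and>
     step_params L \<mu> lam c a \<and> momentum_iterates E f \<mu> lam a x y z"

definition min_grad_sq :: "'a::real_inner set \<Rightarrow> ('a \<Rightarrow> real) \<Rightarrow> (nat \<Rightarrow> 'a) \<Rightarrow> nat \<Rightarrow> real" where
  "min_grad_sq E f x k = Min ((\<lambda>i. (norm (grad_on E f (x i)))\<^sup>2) ` {1..k})"

text \<open>
  The denominator vanishes for \<open>c = 1\<close>, \<open>k = 1\<close>, \<open>lam > 0\<close>; bounds with this denominator are to be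
  stated in \<open>ereal\<close>, where a positive number divided by \<open>0\<close> is \<open>\<infinity>\<close>.
  For \<open>lam = 0\<close> the quotient \<open>ln k / lam\<close> is read as \<open>\<infinity>\<close> (in HOL it would be \<open>0\<close>), so that the
  minimum is its other argument.
\<close>

definition rate_denom :: "real \<Rightarrow> real \<Rightarrow> real \<Rightarrow> real \<Rightarrow> nat \<Rightarrow> real" where
  "rate_denom L \<mu> lam c k =
     c * (1 - c) * real k +
     c * (if lam = 0 then real k * sqrt (c * \<mu> / L)
          else min (ln (real k) / lam) (real k * sqrt (c * \<mu> / L)))"

end

theory Submission
  imports Defs
begin

text \<open>
  Write \<open>v\<^sub>k = \<nabla>\<psi>\<^sup>*(z\<^sub>k) = z\<^sub>k / \<mu>\<close>, \<open>\<theta>\<^sub>k = a\<^sub>k / A\<^sub>k\<close> and \<open>D = f(x\<^sub>0) - f(x\<^sup>*)\<close>. The condition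
  \<open>a\<^sub>k\<^sup>2 / A\<^sub>k\<^bsup>2-\<lambda>\<^esup> = c \<mu> / L\<close> says \<open>\<theta>\<^sub>k\<^sup>2 A\<^sub>k\<^bsup>\<lambda>\<^esup> = c \<mu> / L\<close>. It turns the scheme into
  \<open>x\<^sub>k = y\<^bsub>k-1\<^esub> + \<theta>\<^sub>k (v\<^bsub>k-1\<^esub> - y\<^bsub>k-1\<^esub>)\<close>, \<open>y\<^sub>k = x\<^sub>k - (c/L) \<nabla>f(x\<^sub>k)\<close>,
  \<open>v\<^sub>k = v\<^bsub>k-1\<^esub> - (c / (L \<theta>\<^sub>k)) \<nabla>f(x\<^sub>k)\<close>, and it makes \<open>\<theta>\<^sub>k\<close>
  nonincreasing for \<open>k \<ge> 1\<close>, because \<open>A\<^sub>k\<close> increases.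

  The natural energy is \<open>f(y\<^sub>k) + (L \<theta>\<^bsub>k+1\<^esub>\<^sup>2 / (2c)) \<parallel>v\<^sub>k - y\<^sub>k\<parallel>\<^sup>2\<close>. Estimated with plain convexity and
  the descent lemma alone, it drops by at least \<open>c (1-c) \<parallel>\<nabla>f(x\<^sub>k)\<parallel>\<^sup>2 / (2L)\<close> in a step, which is useless at
  \<open>c = 1\<close>. Both estimates lose something, however. For an \<open>L\<close>-smooth convex function the tangent
  inequality improves by \<open>\<parallel>\<nabla>f(x) - \<nabla>f(y)\<parallel>\<^sup>2 / (2L)\<close> (lemma \<open>cocoercive\<close>). With this version the energy
  drops by at least \<open>c \<parallel>\<nabla>f(y\<^sub>k)\<parallel>\<^sup>2 / (2L) + \<parallel>\<nabla>f(x\<^sub>k) - \<nabla>f(y\<^bsub>k-1\<^esub>)\<parallel>\<^sup>2 / (2L)\<close>, whatever \<open>c \<in> (0,1]\<close> is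
  (lemma \<open>momentum_step\<close>). The two terms belong to neighbouring steps: \<open>\<nabla>f(y\<^bsub>k-1\<^esub>)\<close>, paid for in
  step \<open>k-1\<close>, and \<open>\<nabla>f(x\<^sub>k) - \<nabla>f(y\<^bsub>k-1\<^esub>)\<close> add up to \<open>\<nabla>f(x\<^sub>k)\<close>. After adding
  \<open>c \<parallel>\<nabla>f(y\<^sub>k)\<parallel>\<^sup>2 / (2L)\<close> to the energy, each step therefore lowers it by
  \<open>c \<parallel>\<nabla>f(x\<^sub>k)\<parallel>\<^sup>2 / (4L)\<close> or more
  (lemma \<open>momentum_step_decrease\<close>).

  Telescoping bounds \<open>\<Sum>i=1..k. \<parallel>\<nabla>f(x\<^sub>i)\<parallel>\<^sup>2\<close> by \<open>8 L D / c\<close>, so the smallest term is at most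
  \<open>8 L D / (c k)\<close> (lemma \<open>min_grad_sq_bound\<close>). Since \<open>c \<mu> / L < 1\<close>, the denominator in the claimed
  rate is at most \<open>2 c k\<close>, so this uniform bound implies both parts, with constant 16.
\<close>

section \<open>Smooth convex functions on a subspace\<close>

locale smooth_convex_on_subspace =
  fixes E :: "'a::real_inner set" and f :: "'a \<Rightarrow> real" and L :: real
  assumes subspace: "subspace E" and convex: "convex_on E f"
    and smooth: "smooth_fun_on L E f" and L_pos: "0 < L"
begin

abbreviation "gr \<equiv> grad_on E f"

lemma has_gradient: "x \<in> E \<Longrightarrow> has_gradient_on E f x (gr x)"
  using smooth grad_on_eq[OF subspace] unfolding smooth_fun_on_def by metis

lemma gr_in [simp]: "x \<in> E \<Longrightarrow> gr x \<in> E"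
  using has_gradient by (auto simp: has_gradient_on_def)

lemma gr_lipschitz: "x \<in> E \<Longrightarrow> y \<in> E \<Longrightarrow> norm (gr x - gr y) \<le> L * norm (x - y)"
  using smooth unfolding smooth_fun_on_def by blast

lemma line_in: "x \<in> E \<Longrightarrow> h \<in> E \<Longrightarrow> x + t *\<^sub>R h \<in> E"
  by (intro subspace_add subspace_scale subspace)

lemma deriv_along_line:
  assumes "x \<in> E" "h \<in> E"
  shows "((\<lambda>t. f (x + t *\<^sub>R h)) has_real_derivative gr (x + t *\<^sub>R h) \<bullet> h) (at t)"
proof -
  have sub: "range (\<lambda>t::real. x + t *\<^sub>R h) \<subseteq> E"
    using line_in[OF assms] by blast
  have "(f has_derivative (\<lambda>k. gr (x + t *\<^sub>R h) \<bullet> k))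
      (at (x + t *\<^sub>R h) within range (\<lambda>t::real. x + t *\<^sub>R h))"
    using has_gradient[OF line_in[OF assms]] sub
    by (auto simp: has_gradient_on_def intro: has_derivative_subset)
  moreover have "((\<lambda>t::real. x + t *\<^sub>R h) has_derivative (\<lambda>s. s *\<^sub>R h)) (at t)"
    by (auto intro!: derivative_eq_intros)
  ultimately have "((\<lambda>t. f (x + t *\<^sub>R h)) has_derivative (\<lambda>s. gr (x + t *\<^sub>R h) \<bullet> (s *\<^sub>R h))) (at t)"
    using has_derivative_in_compose[of "\<lambda>t::real. x + t *\<^sub>R h" "\<lambda>s. s *\<^sub>R h" t UNIV
        f "\<lambda>k. gr (x + t *\<^sub>R h) \<bullet> k"] by simp
  moreover have "(\<lambda>s. gr (x + t *\<^sub>R h) \<bullet> (s *\<^sub>R h)) = (*) (gr (x + t *\<^sub>R h) \<bullet> h)"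
    by (simp add: fun_eq_iff)
  ultimately show ?thesis
    by (simp add: has_field_derivative_def)
qed

lemma above_tangent:
  assumes "x \<in> E" "u \<in> E"
  shows "f x + gr x \<bullet> (u - x) \<le> f u"
proof -
  let ?\<phi> = "\<lambda>t::real. f (x + t *\<^sub>R (u - x))"
  have h: "u - x \<in> E"
    using assms subspace by (simp add: subspace_diff)
  have "convex_on UNIV ?\<phi>"
  proof (rule convex_onI)
    fix t s r :: real
    assume t: "0 < t" "t < 1"
    have "x + ((1 - t) *\<^sub>R s + t *\<^sub>R r) *\<^sub>R (u - x)
        = (1 - t) *\<^sub>R (x + s *\<^sub>R (u - x)) + t *\<^sub>R (x + r *\<^sub>R (u - x))"
      by (simp add: algebra_simps)
    then show "?\<phi> ((1 - t) *\<^sub>R s + t *\<^sub>R r) \<le> (1 - t) * ?\<phi> s + t * ?\<phi> r"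
      using convex_onD[OF convex, of t] t line_in[OF assms(1) h] by simp
  qed simp
  moreover have "(?\<phi> has_real_derivative gr x \<bullet> (u - x)) (at 0 within UNIV)"
    using deriv_along_line[OF assms(1) h, of 0] by simp
  ultimately have "?\<phi> 1 - ?\<phi> 0 \<ge> gr x \<bullet> (u - x) * (1 - 0)"
    by (intro convex_on_imp_above_tangent) auto
  then show ?thesis by simp
qed

lemma descent:
  assumes "x \<in> E" "u \<in> E"
  shows "f u \<le> f x + gr x \<bullet> (u - x) + L / 2 * (norm (u - x))\<^sup>2"
proof -
  define h where "h = u - x"
  have h: "h \<in> E"
    using assms subspace by (simp add: h_def subspace_diff)
  let ?\<phi> = "\<lambda>t::real. f (x + t *\<^sub>R h) - t * (gr x \<bullet> h) - L / 2 * t\<^sup>2 * (norm h)\<^sup>2"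
  have "\<exists>y. (?\<phi> has_real_derivative y) (at t) \<and> y \<le> 0" if t: "0 \<le> t" for t
  proof (intro exI conjI)
    show "(?\<phi> has_real_derivative gr (x + t *\<^sub>R h) \<bullet> h - gr x \<bullet> h - L * t * (norm h)\<^sup>2) (at t)"
      by (auto intro!: derivative_eq_intros deriv_along_line assms h)
    have "(gr (x + t *\<^sub>R h) - gr x) \<bullet> h \<le> norm (gr (x + t *\<^sub>R h) - gr x) * norm h"
      by (rule norm_cauchy_schwarz)
    also have "\<dots> \<le> L * norm (t *\<^sub>R h) * norm h"
      using gr_lipschitz[OF line_in[OF assms(1) h] assms(1), of t] by (simp add: mult_right_mono)
    finally show "gr (x + t *\<^sub>R h) \<bullet> h - gr x \<bullet> h - L * t * (norm h)\<^sup>2 \<le> 0"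
      using t by (simp add: inner_diff_left power2_eq_square mult.assoc)
  qed
  then have "?\<phi> 1 \<le> ?\<phi> 0"
    by (intro DERIV_nonpos_imp_nonincreasing[of 0 1 ?\<phi>]) simp_all
  then show ?thesis by (simp add: h_def)
qed

text \<open>
  The function \<open>f - gr y \<bullet> _\<close> is minimal at \<open>y\<close>, so a gradient step of length \<open>1/L\<close> from \<open>x\<close> cannot
  bring it below its value at \<open>y\<close>, although the descent lemma guarantees a definite decrease.
\<close>

lemma cocoercive:
  assumes "x \<in> E" "y \<in> E"
  shows "f y + gr y \<bullet> (x - y) + (norm (gr x - gr y))\<^sup>2 / (2 * L) \<le> f x"
proof -
  define d where "d = gr x - gr y"
  define u where "u = x - (1 / L) *\<^sub>R d"
  have u: "u \<in> E"
    unfolding u_def d_def using assms subspace by (simp add: subspace_diff subspace_scale)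
  have "f y + gr y \<bullet> (u - y) \<le> f x + gr x \<bullet> (u - x) + L / 2 * (norm (u - x))\<^sup>2"
    using above_tangent[OF assms(2) u] descent[OF assms(1) u] by linarith
  moreover have "gr y \<bullet> (u - y) = gr y \<bullet> (x - y) - (gr y \<bullet> d) / L"
    by (simp add: u_def inner_diff_right)
  moreover have "gr x \<bullet> (u - x) = - (gr y \<bullet> d) / L - (norm d)\<^sup>2 / L"
    by (simp add: u_def d_def power2_norm_eq_inner inner_diff_left inner_diff_right
        diff_divide_distrib add_divide_distrib inner_commute)
  moreover have "L / 2 * (norm (u - x))\<^sup>2 = (norm d)\<^sup>2 / (2 * L)"
    using L_pos by (simp add: u_def power_mult_distrib power_divide power2_eq_square)
  moreover have "(norm d)\<^sup>2 / L = 2 * ((norm d)\<^sup>2 / (2 * L))"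
    using L_pos by simp
  ultimately show ?thesis
    unfolding d_def[symmetric] by linarith
qed

lemma grad_sq_le_gap:
  assumes "x \<in> E" "xs \<in> E" "\<And>u. u \<in> E \<Longrightarrow> f xs \<le> f u"
  shows "(norm (gr x))\<^sup>2 \<le> 2 * L * (f x - f xs)"
proof -
  define u where "u = x - (1 / L) *\<^sub>R gr x"
  have "u \<in> E"
    unfolding u_def using assms subspace by (simp add: subspace_diff subspace_scale)
  then have "f xs \<le> f x + gr x \<bullet> (u - x) + L / 2 * (norm (u - x))\<^sup>2"
    using descent[OF assms(1)] assms(3) by (meson order_trans)
  also have "gr x \<bullet> (u - x) = - ((norm (gr x))\<^sup>2 / L)"
    by (simp add: u_def power2_norm_eq_inner)
  also have "L / 2 * (norm (u - x))\<^sup>2 = 1 / 2 * ((norm (gr x))\<^sup>2 / L)"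
    using L_pos by (simp add: u_def power_mult_distrib power_divide power2_eq_square)
  finally have "(norm (gr x))\<^sup>2 / L \<le> 2 * (f x - f xs)"
    by (simp add: algebra_simps)
  then show ?thesis
    using L_pos by (simp add: pos_divide_le_eq mult_ac)
qed

section \<open>One step of the momentum method\<close>

text \<open>
  In lemma \<open>momentum_step\<close> the kinetic term may grow by \<open>c \<parallel>gr x\<parallel>\<^sup>2 / (2L)\<close>, and the gradient step
  has to pay for it. Cocoercivity shows that after this payment
  \<open>((1 - c) \<parallel>gr x - gr y\<parallel>\<^sup>2 + c \<parallel>gr y\<parallel>\<^sup>2) / (2L)\<close> is left, of which the second summand is kept:
  it stays useful up to \<open>c = 1\<close>.
\<close>

lemma gradient_step:
  assumes "x \<in> E" "0 < c" "c \<le> 1" and y: "y = x - (c / L) *\<^sub>R gr x"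
  shows "f y + c / (2 * L) * (norm (gr x))\<^sup>2 + c / (2 * L) * (norm (gr y))\<^sup>2 \<le> f x"
proof -
  have yE: "y \<in> E"
    unfolding y using assms subspace by (simp add: subspace_diff subspace_scale)
  have "gr y \<bullet> (x - y) = c / L * (gr y \<bullet> gr x)"
    by (simp add: y)
  then have "f y + c / L * (gr y \<bullet> gr x) + (norm (gr x - gr y))\<^sup>2 / (2 * L) \<le> f x"
    using cocoercive[OF assms(1) yE] by simp
  moreover have "0 \<le> (1 - c) / (2 * L) * (norm (gr x - gr y))\<^sup>2"
    using assms L_pos by simp
  moreover have "(norm (gr x - gr y))\<^sup>2 / (2 * L) = (1 - c) / (2 * L) * (norm (gr x - gr y))\<^sup>2
      + (c / (2 * L) * (norm (gr x))\<^sup>2 + c / (2 * L) * (norm (gr y))\<^sup>2 - c / L * (gr y \<bullet> gr x))"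
    using L_pos
    by (simp add: power2_norm_eq_inner inner_diff_left inner_diff_right inner_commute field_simps)
  ultimately show ?thesis by linarith
qed

text \<open>
  The weight \<open>L \<theta>\<^sup>2 / (2c)\<close> is the one for which the cross term \<open>\<theta> (v - y) \<bullet> gr x\<close>, produced by moving
  \<open>v\<close>, cancels the first-order change of \<open>f\<close> from \<open>y\<close> to \<open>x\<close>. The new difference \<open>v' - y'\<close> contracts
  by \<open>1 - \<theta>\<close>, and passing to a smaller weight only helps.
\<close>

lemma momentum_step:
  assumes yE: "y \<in> E" and vE: "v \<in> E" and c: "0 < c" "c \<le> 1"
    and \<theta>: "0 < \<theta>" "\<theta> \<le> 1" and \<theta>': "0 \<le> \<theta>'" "\<theta>' \<le> \<theta>"
    and x: "x = y + \<theta> *\<^sub>R (v - y)"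
    and v': "v' = v - (c / (L * \<theta>)) *\<^sub>R gr x"
    and y': "y' = x - (c / L) *\<^sub>R gr x"
  shows "f y' + L * \<theta>'\<^sup>2 / (2 * c) * (norm (v' - y'))\<^sup>2
      + c / (2 * L) * (norm (gr y'))\<^sup>2 + (norm (gr x - gr y))\<^sup>2 / (2 * L)
    \<le> f y + L * \<theta>\<^sup>2 / (2 * c) * (norm (v - y))\<^sup>2"
proof -
  define p where "p = v - y"
  define q where "q = p - (c / (L * \<theta>)) *\<^sub>R gr x"
  have xE: "x \<in> E"
    unfolding x using yE vE by (intro line_in) (simp_all add: subspace subspace_diff)
  have "f x + gr x \<bullet> (y - x) + (norm (gr x - gr y))\<^sup>2 / (2 * L) \<le> f y"
    using cocoercive[OF yE xE] by (simp add: norm_minus_commute)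
  moreover have "gr x \<bullet> (y - x) = - \<theta> * (p \<bullet> gr x)"
    by (simp add: x p_def inner_commute)
  moreover have "f y' + c / (2 * L) * (norm (gr x))\<^sup>2 + c / (2 * L) * (norm (gr y'))\<^sup>2 \<le> f x"
    by (rule gradient_step[OF xE c y'])
  moreover have "L * \<theta>'\<^sup>2 / (2 * c) * (norm (v' - y'))\<^sup>2 \<le> L * \<theta>\<^sup>2 / (2 * c) * (norm q)\<^sup>2"
  proof (rule mult_mono)
    show "L * \<theta>'\<^sup>2 / (2 * c) \<le> L * \<theta>\<^sup>2 / (2 * c)"
      using L_pos c \<theta>' by (intro divide_right_mono mult_left_mono power_mono) auto
    have "\<theta> *\<^sub>R ((c / (L * \<theta>)) *\<^sub>R gr x) = (c / L) *\<^sub>R gr x"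
      using \<theta>(1) by simp
    moreover have "v' - y' = p - (c / (L * \<theta>)) *\<^sub>R gr x - \<theta> *\<^sub>R p + (c / L) *\<^sub>R gr x"
      unfolding v' y' by (simp add: x p_def)
    ultimately have "v' - y' = (1 - \<theta>) *\<^sub>R q"
      unfolding q_def scaleR_left_diff_distrib scaleR_right_diff_distrib using \<theta>(1) by simp
    then have "norm (v' - y') \<le> norm q"
      using \<theta> by (simp add: mult_left_le_one_le)
    then show "(norm (v' - y'))\<^sup>2 \<le> (norm q)\<^sup>2"
      by (simp add: power_mono)
  qed (use L_pos c in auto)
  moreover have "L * \<theta>\<^sup>2 / (2 * c) * (norm q)\<^sup>2
      = L * \<theta>\<^sup>2 / (2 * c) * (norm p)\<^sup>2 - \<theta> * (p \<bullet> gr x) + c / (2 * L) * (norm (gr x))\<^sup>2"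
    using L_pos c \<theta>
    by (simp add: q_def power2_norm_eq_inner inner_diff_left inner_diff_right inner_commute)
      (simp add: field_simps power2_eq_square)
  ultimately show ?thesis
    unfolding p_def by linarith
qed

lemma momentum_step_decrease:
  assumes yE: "y \<in> E" and vE: "v \<in> E" and c: "0 < c" "c \<le> 1"
    and \<theta>: "0 < \<theta>" "\<theta> \<le> 1" and \<theta>': "0 \<le> \<theta>'" "\<theta>' \<le> \<theta>"
    and x: "x = y + \<theta> *\<^sub>R (v - y)"
    and v': "v' = v - (c / (L * \<theta>)) *\<^sub>R gr x"
    and y': "y' = x - (c / L) *\<^sub>R gr x"
  shows "f y' + L * \<theta>'\<^sup>2 / (2 * c) * (norm (v' - y'))\<^sup>2 + c / (2 * L) * (norm (gr y'))\<^sup>2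
      + c / (4 * L) * (norm (gr x))\<^sup>2
    \<le> f y + L * \<theta>\<^sup>2 / (2 * c) * (norm (v - y))\<^sup>2 + c / (2 * L) * (norm (gr y))\<^sup>2"
proof -
  have "(norm (gr x))\<^sup>2 \<le> (norm (gr x - gr y) + norm (gr y))\<^sup>2"
    using norm_triangle_ineq[of "gr x - gr y" "gr y"] by (intro power_mono) auto
  also have "\<dots> \<le> 2 * (norm (gr x - gr y))\<^sup>2 + 2 * (norm (gr y))\<^sup>2"
    using sum_squares_bound[of "norm (gr x - gr y)" "norm (gr y)"] by (simp add: power2_sum)
  finally have "c / (4 * L) * (norm (gr x))\<^sup>2
      \<le> c / (4 * L) * (2 * (norm (gr x - gr y))\<^sup>2 + 2 * (norm (gr y))\<^sup>2)"
    using c L_pos by (intro mult_left_mono) auto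
  also have "\<dots> = c * ((norm (gr x - gr y))\<^sup>2 / (2 * L)) + c / (2 * L) * (norm (gr y))\<^sup>2"
    using L_pos by (simp add: field_simps)
  also have "\<dots> \<le> (norm (gr x - gr y))\<^sup>2 / (2 * L) + c / (2 * L) * (norm (gr y))\<^sup>2"
    using c L_pos by (intro add_right_mono mult_left_le_one_le) auto
  finally show ?thesis
    using momentum_step[OF assms] by linarith
qed

end

section \<open>The iterates and the rate\<close>

definition step_ratio :: "(nat \<Rightarrow> real) \<Rightarrow> nat \<Rightarrow> real" where
  "step_ratio a k = a k / (\<Sum>i\<le>k. a i)"

lemma step_ratio_properties:
  assumes "step_params L \<mu> lam c a"
  shows step_ratio_pos: "0 < step_ratio a k"
    and step_ratio_le_1: "step_ratio a k \<le> 1"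
    and step_ratio_sq: "k \<ge> 1 \<Longrightarrow> (step_ratio a k)\<^sup>2 * (\<Sum>i\<le>k. a i) powr lam = c * (\<mu> / L)"
    and step_ratio_Suc_le: "k \<ge> 1 \<Longrightarrow> step_ratio a (Suc k) \<le> step_ratio a k"
proof -
  let ?A = "\<lambda>k. \<Sum>i\<le>k. a i"
  have a: "0 < a i" for i
    using assms by (simp add: step_params_def)
  have A: "0 < ?A k" for k
    by (intro sum_pos) (use a in auto)
  show pos: "0 < step_ratio a k" for k
    using a A by (simp add: step_ratio_def)
  have "a k \<le> ?A k"
    by (rule member_le_sum) (use a in \<open>auto intro: less_imp_le\<close>)
  then show "step_ratio a k \<le> 1"
    using A by (simp add: step_ratio_def)
  have sq: "(step_ratio a k)\<^sup>2 * ?A k powr lam = c * (\<mu> / L)" if "k \<ge> 1" for k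
  proof -
    have "(a k)\<^sup>2 / ?A k powr (2 - lam) = c * (\<mu> / L)"
      using assms that by (simp add: step_params_def)
    moreover have "?A k powr (2 - lam) = (?A k)\<^sup>2 / ?A k powr lam"
      using A[of k] by (simp add: powr_diff)
    ultimately show ?thesis
      by (simp add: step_ratio_def power_divide)
  qed
  then show "k \<ge> 1 \<Longrightarrow> (step_ratio a k)\<^sup>2 * ?A k powr lam = c * (\<mu> / L)" .
  assume k: "k \<ge> 1"
  have "?A k powr lam \<le> ?A (Suc k) powr lam"
    using assms less_imp_le[OF a[of "Suc k"]] less_imp_le[OF A[of k]]
    by (intro powr_mono2) (auto simp: step_params_def)
  then have "(step_ratio a (Suc k))\<^sup>2 * ?A k powr lam \<le> (step_ratio a (Suc k))\<^sup>2 * ?A (Suc k) powr lam"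
    by (intro mult_left_mono) auto
  also have "\<dots> = (step_ratio a k)\<^sup>2 * ?A k powr lam"
    using sq[OF k] sq[of "Suc k"] by simp
  finally have "(step_ratio a (Suc k))\<^sup>2 \<le> (step_ratio a k)\<^sup>2"
    using A[of k] by simp
  then show "step_ratio a (Suc k) \<le> step_ratio a k"
    by (rule power2_le_imp_le[OF _ less_imp_le[OF pos]])
qed

lemma momentum_setting_locale:
  assumes "momentum_setting E f xs L \<mu> lam c a x y z"
  shows "smooth_convex_on_subspace E f L"
  using assms subspace_span
  by (auto simp: momentum_setting_def euclidean_subspace_def smooth_convex_on_subspace_def
      step_params_def)

text \<open>
  In terms of \<open>v\<close> and \<open>\<theta>\<close>, one iteration has the shape required by lemma \<open>momentum_step_decrease\<close>:
  \<open>step_ratio_sq\<close> makes the coefficient \<open>\<theta>\<^sub>k A\<^sub>k\<^bsup>\<lambda>\<^esup> / \<mu>\<close> of the gradient equal to \<open>c / (L \<theta>\<^sub>k)\<close>.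
\<close>

lemma momentum_iterates_normal_form:
  assumes "momentum_setting E f xs L \<mu> lam c a x y z"
    and v_def: "v = (\<lambda>k. z k /\<^sub>R \<mu>)" and \<theta>_def: "\<theta> = step_ratio a"
  shows "y 0 = x 0" "v 0 = y 0" "y k \<in> E" "v k \<in> E"
    and "x (Suc k) = y k + \<theta> (Suc k) *\<^sub>R (v k - y k)"
    and "v (Suc k) = v k - (c / (L * \<theta> (Suc k))) *\<^sub>R grad_on E f (x (Suc k))"
    and "y (Suc k) = x (Suc k) - (c / L) *\<^sub>R grad_on E f (x (Suc k))"
proof -
  interpret smooth_convex_on_subspace E f L
    by (rule momentum_setting_locale[OF assms(1)])
  let ?A = "\<lambda>k. \<Sum>i\<le>k. a i"
  have par: "step_params L \<mu> lam c a" and it: "momentum_iterates E f \<mu> lam a x y z"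
    using assms(1) by (auto simp: momentum_setting_def)
  have \<mu>: "0 < \<mu>" and c: "0 < c" and a: "0 < a i" for i
    using par by (auto simp: step_params_def)
  have A: "0 < ?A k" for k
    by (intro sum_pos) (use a in auto)
  have \<theta>: "0 < \<theta> k" for k
    using step_ratio_pos[OF par] by (simp add: \<theta>_def)
  have psi: "grad_on E (psi_star \<mu>) w = w /\<^sub>R \<mu>" if "w \<in> E" for w
    by (rule grad_on_psi_star[OF subspace that \<mu>])
  have z0: "z 0 \<in> E" "x 0 = grad_on E (psi_star \<mu>) (z 0)" "y 0 = grad_on E (psi_star \<mu>) (z 0)"
    and xS: "x (Suc k) = (?A k / ?A (Suc k)) *\<^sub>R y k
        + (a (Suc k) / ?A (Suc k)) *\<^sub>R grad_on E (psi_star \<mu>) (z k)"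
    and zS: "z (Suc k) = z k - (a (Suc k) / ?A (Suc k) * ?A (Suc k) powr lam) *\<^sub>R gr (x (Suc k))"
    and yS: "y (Suc k) = x (Suc k) + (a (Suc k) / ?A (Suc k)) *\<^sub>R
        (grad_on E (psi_star \<mu>) (z (Suc k)) - grad_on E (psi_star \<mu>) (z k))" for k
    using it unfolding momentum_iterates_def Let_def by (force simp del: sum.atMost_Suc)+
  show "y 0 = x 0" "v 0 = y 0"
    using z0 psi by (simp_all add: v_def)
  have mem: "z k \<in> E \<and> y k \<in> E" for k
  proof (induction k)
    case 0
    then show ?case
      using z0 psi by (simp add: subspace subspace_scale)
  next
    case (Suc k)
    have xE: "x (Suc k) \<in> E"
      unfolding xS using Suc psi by (simp add: subspace subspace_scale subspace_add)
    then have zE: "z (Suc k) \<in> E"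
      unfolding zS using Suc by (simp add: subspace subspace_scale subspace_diff)
    have "y (Suc k) \<in> E"
      unfolding yS using Suc xE zE psi
      by (simp add: subspace subspace_scale subspace_diff subspace_add)
    with zE show ?case ..
  qed
  show "y k \<in> E" "v k \<in> E"
    using mem by (simp_all add: v_def subspace subspace_scale)
  have "?A k / ?A (Suc k) = 1 - \<theta> (Suc k)"
    using A[of "Suc k"] by (simp add: \<theta>_def step_ratio_def field_simps)
  moreover have "x (Suc k) = (?A k / ?A (Suc k)) *\<^sub>R y k + \<theta> (Suc k) *\<^sub>R v k"
    using xS[of k] mem psi by (simp add: v_def \<theta>_def step_ratio_def del: sum.atMost_Suc)
  ultimately show "x (Suc k) = y k + \<theta> (Suc k) *\<^sub>R (v k - y k)"
    by (simp only: scaleR_left_diff_distrib scaleR_right_diff_distrib scaleR_one) simp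
  have "\<theta> (Suc k) * ?A (Suc k) powr lam = c * \<mu> / (L * \<theta> (Suc k))"
    using step_ratio_sq[OF par, of "Suc k"] \<theta>[of "Suc k"] L_pos
    by (simp add: \<theta>_def field_simps power2_eq_square del: sum.atMost_Suc)
  then have "z (Suc k) = z k - (c * \<mu> / (L * \<theta> (Suc k))) *\<^sub>R gr (x (Suc k))"
    unfolding zS by (simp add: \<theta>_def step_ratio_def del: sum.atMost_Suc)
  then show vS: "v (Suc k) = v k - (c / (L * \<theta> (Suc k))) *\<^sub>R gr (x (Suc k))"
    using \<mu> by (simp add: v_def scaleR_diff_right)
  have "y (Suc k) = x (Suc k) + \<theta> (Suc k) *\<^sub>R (v (Suc k) - v k)"
    using yS[of k] mem psi by (simp add: v_def \<theta>_def step_ratio_def del: sum.atMost_Suc)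
  then show "y (Suc k) = x (Suc k) - (c / L) *\<^sub>R gr (x (Suc k))"
    using \<theta>[of "Suc k"] by (simp add: vS)
qed

lemma min_grad_sq_bound:
  assumes set: "momentum_setting E f xs L \<mu> lam c a x y z" and k: "k \<ge> 1"
  shows "min_grad_sq E f x k \<le> 8 * (L * (f (x 0) - f xs)) / (c * real k)"
proof -
  interpret smooth_convex_on_subspace E f L
    by (rule momentum_setting_locale[OF set])
  define v where "v = (\<lambda>k. z k /\<^sub>R \<mu>)"
  define \<theta> where "\<theta> = step_ratio a"
  define \<Phi> where "\<Phi> = (\<lambda>k. f (y k) + L * (\<theta> (Suc k))\<^sup>2 / (2 * c) * (norm (v k - y k))\<^sup>2
    + c / (2 * L) * (norm (gr (y k)))\<^sup>2)"
  have par: "step_params L \<mu> lam c a" and xs: "xs \<in> E" "\<And>u. u \<in> E \<Longrightarrow> f xs \<le> f u"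
    using set by (auto simp: momentum_setting_def)
  have c: "0 < c" "c \<le> 1"
    using par by (auto simp: step_params_def)
  note nf = momentum_iterates_normal_form[OF set v_def \<theta>_def]
  have step: "\<Phi> (Suc n) + c / (4 * L) * (norm (gr (x (Suc n))))\<^sup>2 \<le> \<Phi> n" for n
    unfolding \<Phi>_def
    by (rule momentum_step_decrease[OF nf(3,4) c _ _ _ _ nf(5-7)])
      (auto simp: \<theta>_def intro!: step_ratio_pos[OF par] step_ratio_le_1[OF par]
        step_ratio_Suc_le[OF par] less_imp_le[OF step_ratio_pos[OF par]])
  have tele: "\<Phi> n + c / (4 * L) * (\<Sum>i=1..n. (norm (gr (x i)))\<^sup>2) \<le> \<Phi> 0" for n
  proof (induction n)
    case (Suc n)
    then show ?case
      using step[of n] by (simp add: distrib_left)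
  qed simp
  let ?D = "f (x 0) - f xs"
  have x0: "x 0 \<in> E"
    using nf(1) nf(3)[of 0] by simp
  have "0 \<le> ?D"
    using xs(2)[OF x0] by simp
  have "c / (2 * L) * (norm (gr (x 0)))\<^sup>2 \<le> c / (2 * L) * (2 * L * ?D)"
    using c L_pos grad_sq_le_gap[OF x0 xs] by (intro mult_left_mono) auto
  also have "\<dots> = c * ?D"
    using L_pos by simp
  also have "\<dots> \<le> ?D"
    using c \<open>0 \<le> ?D\<close> by (intro mult_left_le_one_le) auto
  finally have "\<Phi> 0 \<le> f (x 0) + ?D"
    using nf(1,2) by (simp add: \<Phi>_def)
  moreover have "f xs \<le> \<Phi> k"
  proof -
    have "0 \<le> L * (\<theta> (Suc k))\<^sup>2 / (2 * c) * (norm (v k - y k))\<^sup>2"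
      "0 \<le> c / (2 * L) * (norm (gr (y k)))\<^sup>2"
      using c L_pos by simp_all
    then show ?thesis
      using xs(2)[OF nf(3)[of k]] unfolding \<Phi>_def by linarith
  qed
  ultimately have "\<Phi> 0 - \<Phi> k \<le> 2 * ?D"
    by simp
  moreover have "c / (4 * L) * (\<Sum>i=1..k. (norm (gr (x i)))\<^sup>2) \<le> \<Phi> 0 - \<Phi> k"
    using tele[of k] by (simp only: le_diff_eq add.commute)
  ultimately have sum: "c / (4 * L) * (\<Sum>i=1..k. (norm (gr (x i)))\<^sup>2) \<le> 2 * ?D"
    by (rule order_trans[rotated])
  have "real k * min_grad_sq E f x k = (\<Sum>i=1..k. min_grad_sq E f x k)"
    by simp
  also have "\<dots> \<le> (\<Sum>i=1..k. (norm (gr (x i)))\<^sup>2)"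
    unfolding min_grad_sq_def by (intro sum_mono Min_le) auto
  finally have "c / (4 * L) * (real k * min_grad_sq E f x k) \<le> 2 * ?D"
    using sum c L_pos by (meson mult_left_mono order_trans divide_nonneg_nonneg
        mult_nonneg_nonneg less_imp_le zero_le_numeral)
  then show ?thesis
    using c L_pos k by (simp add: field_simps)
qed

text \<open>
  The minimum is at most its second entry, and the square root there is less than 1. The logarithm
  can only make the denominator smaller.
\<close>

lemma rate_denom_bounds:
  assumes "step_params L \<mu> lam c a" "k \<ge> 1"
  shows "0 \<le> rate_denom L \<mu> lam c k" "rate_denom L \<mu> lam c k \<le> 2 * (c * real k)"
proof -
  let ?m = "if lam = 0 then real k * sqrt (c * \<mu> / L)
    else min (ln (real k) / lam) (real k * sqrt (c * \<mu> / L))"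
  have p: "0 < \<mu>" "\<mu> < L" "0 \<le> lam" "0 < c" "c \<le> 1" "c * \<mu> / L < 1"
    using assms(1) by (auto simp: step_params_def)
  have "0 \<le> ?m"
    using p assms(2) by auto
  moreover have "?m \<le> real k"
  proof -
    have "real k * sqrt (c * \<mu> / L) \<le> real k * 1"
      using p by (intro mult_left_mono) auto
    then show ?thesis by auto
  qed
  ultimately have m: "0 \<le> c * ?m" "c * ?m \<le> c * real k"
    using p by (auto intro: mult_left_mono mult_nonneg_nonneg simp del: mult_le_cancel_left)
  have "0 \<le> c * (1 - c) * real k" "c * (1 - c) * real k \<le> c * real k"
    using p by (auto intro!: mult_right_mono mult_left_le_one_le)
  then show "0 \<le> rate_denom L \<mu> lam c k" "rate_denom L \<mu> lam c k \<le> 2 * (c * real k)"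
    using m unfolding rate_denom_def by linarith+
qed

theorem corollary4p7:
  shows "(\<exists>C>0. \<forall>(E :: 'a::real_inner set) f xs L \<mu> lam c a x y z.
            momentum_setting E f xs L \<mu> lam c a x y z \<longrightarrow>
            (\<forall>k\<ge>1. ereal (min_grad_sq E f x k)
                    \<le> ereal C * (ereal (L * (f (x 0) - f xs)) / ereal (rate_denom L \<mu> lam c k))))
       \<and> (\<exists>C>0. \<forall>(E :: 'a::real_inner set) f xs L \<mu> lam a x y z.
            momentum_setting E f xs L \<mu> lam (1/2) a x y z \<longrightarrow>
            (\<forall>k\<ge>1. min_grad_sq E f x k \<le> C * (L * (f (x 0) - f xs) / real k)))"
proof (intro conjI exI[of _ "16::real"] allI impI)
  fix E :: "'a set" and f xs L \<mu> lam c a x y z and k :: nat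
  assume set: "momentum_setting E f xs L \<mu> lam c a x y z" and k: "k \<ge> 1"
  define N where "N = L * (f (x 0) - f xs)"
  define R where "R = rate_denom L \<mu> lam c k"
  have par: "step_params L \<mu> lam c a"
    using set by (simp add: momentum_setting_def)
  have c: "0 < c" "0 < L"
    using par by (auto simp: step_params_def)
  have "x 0 \<in> E"
    using momentum_iterates_normal_form(1,3)[OF set refl refl] by metis
  then have N: "0 \<le> N"
    using set c by (simp add: N_def momentum_setting_def)
  have R: "0 \<le> R" "R \<le> 2 * (c * real k)"
    using rate_denom_bounds[OF par k] by (simp_all add: R_def)
  have le: "min_grad_sq E f x k \<le> 8 * N / (c * real k)"
    using min_grad_sq_bound[OF set k] by (simp add: N_def)
  consider "R > 0" | "R = 0" "N > 0" | "R = 0" "N = 0"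
    using R(1) N by linarith
  then show "ereal (min_grad_sq E f x k)
      \<le> ereal 16 * (ereal (L * (f (x 0) - f xs)) / ereal (rate_denom L \<mu> lam c k))"
    unfolding N_def[symmetric] R_def[symmetric]
  proof cases
    case 1
    have "8 * N / (c * real k) = 16 * N / (2 * (c * real k))"
      by simp
    also have "\<dots> \<le> 16 * N / R"
      using 1 R N c k by (intro divide_left_mono) auto
    finally show "ereal (min_grad_sq E f x k) \<le> ereal 16 * (ereal N / ereal R)"
      using le 1 by simp
  next
    case 2
    then show "ereal (min_grad_sq E f x k) \<le> ereal 16 * (ereal N / ereal R)"
      by (simp add: divide_ereal_def)
  next
    \<comment> \<open>In \<open>ereal\<close> the quotient \<open>0 / 0\<close> is \<open>0\<close>, and the bound before division by \<open>R\<close> is 0 as well.\<close>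
    case 3
    then show "ereal (min_grad_sq E f x k) \<le> ereal 16 * (ereal N / ereal R)"
      using le by simp
  qed
next
  fix E :: "'a set" and f xs L \<mu> lam a x y z and k :: nat
  assume "momentum_setting E f xs L \<mu> lam (1/2) a x y z" and "k \<ge> 1"
  from min_grad_sq_bound[OF this]
  show "min_grad_sq E f x k \<le> 16 * (L * (f (x 0) - f xs) / real k)"
    by (simp add: field_simps)
qed simp_all

end
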